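(* Let $m\ge 3$ be an odd integer. For $0\le i\le m$ let $\lambda_i=(m-i)^2-i$ (the eigenvalues of the Johnson graph $J(2m,m)$) and $\theta_i=\lambda_i+(-1)^i$. Then the spectrum of the enhanced Johnson graph $EJ(2m,m)$ consists of the eigenvalues $\theta_i$, $0\le i\le m$, where $\theta_i$ has multiplicity $m(\theta_i)=\binom{2m}{i}-\binom{2m}{i-1}$.
   Context: The Johnson graph $J(2m,m)$ has as vertices the $m$-subsets of $\{1,\dots,2m\}$, with $u,v$ adjacent if and only if $|u\cap v|=m-1$. The enhanced Johnson graph $EJ(2m,m)$ is obtained from $J(2m,m)$ by adding an edge between each $m$-subset $v$ and its complement $v^c=\{1,\dots,2m\}\setminus v$. The spectrum of a graph is the list of eigenvalues of its adjacency matrix together with their multiplicities. The eigenvalues of $J(2m,m)$ are indexed as $\lambda_i=(m-i)(2m-m-i)-i=(m-i)^2-i$, $0\le i\le m$. Convention: $\binom{n}{-1}=0$. *)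

theory Defs
  imports
    "Graph_Theory.Pair_Digraph"
    "Jordan_Normal_Form.Spectral_Radius"
begin

text \<open>
  An undirected simple graph is a \<open>pair_graph\<close>, i.e. a finite, loop-free digraph whose
  arc relation is symmetric; each edge is represented by its two arcs.
\<close>

definition johnson_graph :: "nat \<Rightarrow> nat \<Rightarrow> nat set pair_pre_digraph" where
  "johnson_graph n k =
     (let V = {v. v \<subseteq> {1..n} \<and> card v = k}
      in \<lparr> pverts = V,
          parcs = {(u, v). u \<in> V \<and> v \<in> V \<and> card (u \<inter> v) = k - 1} \<rparr>)"

definition enhanced_johnson_graph :: "nat \<Rightarrow> nat set pair_pre_digraph" where
  "enhanced_johnson_graph m =
     \<lparr> pverts = pverts (johnson_graph (2 * m) m),
       parcs = parcs (johnson_graph (2 * m) m) \<union>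
         {(v, {1..2 * m} - v) | v. v \<in> pverts (johnson_graph (2 * m) m)} \<rparr>"

text \<open>
  The adjacency matrix with respect to a list \<open>vs\<close> enumerating the vertices
  without repetition.
\<close>

definition adjacency_matrix :: "'a pair_pre_digraph \<Rightarrow> 'a list \<Rightarrow> 'b :: zero_neq_one mat" where
  "adjacency_matrix G vs =
     mat (length vs) (length vs) (\<lambda>(i, j). if (vs ! i, vs ! j) \<in> parcs G then 1 else 0)"

definition johnson_eigenvalue :: "nat \<Rightarrow> nat \<Rightarrow> int" where
  "johnson_eigenvalue m i = (int m - int i)^2 - int i"

definition enhanced_johnson_eigenvalue :: "nat \<Rightarrow> nat \<Rightarrow> int" where
  "enhanced_johnson_eigenvalue m i = johnson_eigenvalue m i + (-1) ^ i"

text \<open>The case \<open>i = 0\<close> implements the convention that \<open>n choose (-1)\<close> is \<open>0\<close>.\<close>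

definition enhanced_johnson_multiplicity :: "nat \<Rightarrow> nat \<Rightarrow> int" where
  "enhanced_johnson_multiplicity m i =
     int ((2 * m) choose i) - (if i = 0 then 0 else int ((2 * m) choose (i - 1)))"

lemma finite_johnson_verts: "finite (pverts (johnson_graph n k))"
  by (rule finite_subset[of _ "Pow {1..n}"]) (auto simp: johnson_graph_def Let_def)

lemma pair_graph_johnson_graph:
  assumes "k \<ge> 1"
  shows "pair_graph (johnson_graph n k)"
proof -
  let ?G = "johnson_graph n k"
  have wf: "fst e \<in> pverts ?G" "snd e \<in> pverts ?G" "fst e \<noteq> snd e" if e: "e \<in> parcs ?G" for e
  proof -
    obtain u v where uv: "e = (u, v)" by (cases e)
    have arc: "u \<in> pverts ?G" "v \<in> pverts ?G" "card (u \<inter> v) = k - 1" "card v = k"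
      using e unfolding uv by (simp_all add: johnson_graph_def Let_def)
    have "u \<noteq> v"
    proof
      assume "u = v"
      then have "k = k - 1" using arc(3,4) by simp
      with assms show False by linarith
    qed
    with arc(1,2) show "fst e \<in> pverts ?G" "snd e \<in> pverts ?G" "fst e \<noteq> snd e"
      unfolding uv by simp_all
  qed
  have "parcs ?G \<subseteq> pverts ?G \<times> pverts ?G"
    using wf(1,2) by (simp add: subset_iff mem_Times_iff)
  then have fin: "finite (parcs ?G)"
    by (rule finite_subset[OF _ finite_cartesian_product[OF finite_johnson_verts finite_johnson_verts]])
  have "symmetric ?G"
    by (simp add: johnson_graph_def Let_def symmetric_def sym_def Int_commute)
  with fin show ?thesis
    by unfold_locales (simp_all add: wf finite_johnson_verts)
qed

lemma compl_in_johnson_verts: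
  assumes "v \<in> pverts (johnson_graph (2 * m) m)"
  shows "{1..2 * m} - v \<in> pverts (johnson_graph (2 * m) m)"
proof -
  have v: "v \<subseteq> {1..2 * m}" "card v = m"
    using assms by (auto simp: johnson_graph_def Let_def)
  then have "card ({1..2 * m} - v) = m"
    by (simp add: card_Diff_subset finite_subset[OF v(1)])
  then show ?thesis by (simp add: johnson_graph_def Let_def)
qed

lemma pair_graph_enhanced_johnson_graph:
  assumes "m \<ge> 1"
  shows "pair_graph (enhanced_johnson_graph m)"
proof -
  interpret J: pair_graph "johnson_graph (2 * m) m"
    by (rule pair_graph_johnson_graph[OF assms])
  have sub: "v \<subseteq> {1..2 * m}" "v \<noteq> {}" if "v \<in> pverts (johnson_graph (2 * m) m)" for v
    using that assms by (auto simp: johnson_graph_def Let_def)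
  let ?C = "{(v, {1..2 * m} - v) | v. v \<in> pverts (johnson_graph (2 * m) m)}"
  have "sym ?C"
  proof (rule symI)
    fix a b assume "(a, b) \<in> ?C"
    then have a: "a \<in> pverts (johnson_graph (2 * m) m)" and b: "b = {1..2 * m} - a" by auto
    have "a = {1..2 * m} - b" using sub(1)[OF a] b by auto
    then show "(b, a) \<in> ?C" using compl_in_johnson_verts[OF a] b by blast
  qed
  moreover have "sym (parcs (johnson_graph (2 * m) m))"
    using J.pair_sym_arcs by (simp add: symmetric_def)
  ultimately have sy: "sym (parcs (enhanced_johnson_graph m))"
    unfolding enhanced_johnson_graph_def by (simp add: sym_Un)
  have wf: "fst e \<in> pverts (enhanced_johnson_graph m) \<and> snd e \<in> pverts (enhanced_johnson_graph m)
      \<and> fst e \<noteq> snd e" if e: "e \<in> parcs (enhanced_johnson_graph m)" for e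
  proof (cases "e \<in> parcs (johnson_graph (2 * m) m)")
    case True
    then show ?thesis
      using J.arc_fst_in_verts J.arc_snd_in_verts J.pair_no_loops
      by (auto simp: enhanced_johnson_graph_def)
  next
    case False
    then obtain v where v: "v \<in> pverts (johnson_graph (2 * m) m)" "e = (v, {1..2 * m} - v)"
      using e by (auto simp: enhanced_johnson_graph_def)
    then show ?thesis
      using compl_in_johnson_verts[OF v(1)] sub[OF v(1)]
      by (auto simp: enhanced_johnson_graph_def)
  qed
  have fin: "finite (pverts (enhanced_johnson_graph m))"
    by (simp add: enhanced_johnson_graph_def finite_johnson_verts)
  have "parcs (enhanced_johnson_graph m) \<subseteq>
      pverts (enhanced_johnson_graph m) \<times> pverts (enhanced_johnson_graph m)"
  proof
    fix e assume "e \<in> parcs (enhanced_johnson_graph m)"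
    from wf[OF this] show "e \<in> pverts (enhanced_johnson_graph m) \<times> pverts (enhanced_johnson_graph m)"
      unfolding mem_Times_iff by blast
  qed
  then have "finite (parcs (enhanced_johnson_graph m))"
    by (rule finite_subset[OF _ finite_cartesian_product[OF fin fin]])
  with fin sy show ?thesis
    by unfold_locales (simp_all add: wf symmetric_def)
qed

end

theory Submission
  imports Defs "Jordan_Normal_Form.Jordan_Normal_Form_Uniqueness"
begin

text \<open>
  The eigenvectors are built from \<^emph>\<open>harmonic\<close> functions. A function \<open>f\<close> on the \<open>i\<close>-subsets of
  \<open>\<Omega> = {1..2 * m}\<close> is harmonic if, for every \<open>(i - 1)\<close>-subset \<open>R\<close>, its values on the
  \<open>i\<close>-subsets above \<open>R\<close> add up to \<open>0\<close>. These are \<open>(2 * m) choose (i - 1)\<close> linear conditions on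
  \<open>(2 * m) choose i\<close> values, so the space of harmonic functions has at least the dimension claimed
  for the \<open>i\<close>-th eigenspace. The eigenvector that belongs to \<open>f\<close> is its lift to \<open>m\<close>-subsets, the
  function \<open>F\<close> with \<open>F T = (\<Sum>S. f S)\<close>, where \<open>S\<close> ranges over the \<open>i\<close>-subsets of \<open>T\<close>.

  Everything about \<open>F\<close> follows from one recurrence (\<open>meet_sum_recurrence\<close>). Let \<open>a j\<close> be the sum
  of \<open>f\<close> over the \<open>i\<close>-subsets that meet a fixed set \<open>T\<close> in exactly \<open>j\<close> points. Adding the harmonicity
  conditions at the sets \<open>R\<close> that meet \<open>T\<close> in \<open>j\<close> points gives
  \<open>(j + 1) * a (j + 1) + (i - j) * a j = 0\<close>. This has three consequences.

    \<^item> Solving the recurrence yields \<open>a i = (-1)^i * a 0\<close>, that is, \<open>F\<close> is multiplied by \<open>(-1)^i\<close> when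
      \<open>T\<close> is replaced by its complement (\<open>subset_sum_compl\<close>).

    \<^item> The sum of the lift over all \<open>insert y R\<close> is a scalar multiple of the lift at \<open>R\<close>
      (\<open>sum_subset_sum_insert\<close>). Removing one point and inserting another one therefore acts
      as a scalar, and \<open>F\<close> is an eigenvector of the Johnson graph (\<open>subset_sum_johnson\<close>).

    \<^item> That scalar is nonzero when \<open>R\<close> has at least \<open>i\<close> and less than \<open>m\<close> points. In this range,
      a lift that vanishes on all sets of one size vanishes on the sets of the next smaller
      size. Hence \<open>F = 0\<close> only if \<open>f = 0\<close>
      (\<open>harmonic_eq_0_if_subset_sum_eq_0\<close>).

  So the value \<open>\<lambda>\<^sub>i + (-1)^i\<close> is an eigenvalue whose geometric multiplicity, and hence also
  its algebraic multiplicity, is at least \<open>(2 * m) choose i - (2 * m) choose (i - 1)\<close>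
  (\<open>enhanced_johnson_order_ge\<close>). For odd \<open>m\<close> these values are pairwise distinct, and the bounds
  telescope to \<open>(2 * m) choose m\<close>, the degree of the characteristic polynomial. Therefore all the
  bounds are attained and there is no room for another eigenvalue.
\<close>

section \<open>Harmonic functions on the subsets of a given size\<close>

definition k_subsets :: "'a set \<Rightarrow> nat \<Rightarrow> 'a set set" where
  "k_subsets \<Omega> k = {S. S \<subseteq> \<Omega> \<and> card S = k}"

text \<open>
  Such functions form the kernel of the map that sends a function on the \<open>i\<close>-subsets to its
  sums over the \<open>i\<close>-subsets above each \<open>(i - 1)\<close>-subset. Writing the size condition as
  \<open>Suc (card R) = i\<close> makes it unsatisfiable for \<open>i = 0\<close>, where every function is therefore harmonic.
\<close>

definition harmonic :: "'a set \<Rightarrow> nat \<Rightarrow> ('a set \<Rightarrow> 'b::comm_ring_1) \<Rightarrow> bool" where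
  "harmonic \<Omega> i f \<longleftrightarrow>
     (\<forall>R. R \<subseteq> \<Omega> \<and> Suc (card R) = i \<longrightarrow> (\<Sum>x\<in>\<Omega> - R. f (insert x R)) = 0)"

text \<open>
  As \<open>T\<close> ranges over the \<open>k\<close>-subsets, this is the lift of a function on \<open>i\<close>-subsets to
  \<open>k\<close>-subsets by the inclusion matrix.
\<close>

definition subset_sum :: "nat \<Rightarrow> ('a set \<Rightarrow> 'b::comm_ring_1) \<Rightarrow> 'a set \<Rightarrow> 'b" where
  "subset_sum i f T = (\<Sum>S\<in>k_subsets T i. f S)"

text \<open>
  These sums interpolate between the lift to \<open>T\<close> (all of \<open>S\<close> in \<open>T\<close>, \<open>j = i\<close>) and the lift to the
  complement of \<open>T\<close> (\<open>j = 0\<close>).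
\<close>

definition meet_sum :: "'a set \<Rightarrow> nat \<Rightarrow> ('a set \<Rightarrow> 'b::comm_ring_1) \<Rightarrow> 'a set \<Rightarrow> nat \<Rightarrow> 'b" where
  "meet_sum \<Omega> i f T j = (\<Sum>S\<in>{S \<in> k_subsets \<Omega> i. card (S \<inter> T) = j}. f S)"

lemma finite_k_subsets: "finite \<Omega> \<Longrightarrow> finite (k_subsets \<Omega> k)"
  by (rule finite_subset[of _ "Pow \<Omega>"]) (auto simp: k_subsets_def)

lemma card_k_subsets: "finite \<Omega> \<Longrightarrow> card (k_subsets \<Omega> k) = card \<Omega> choose k"
  unfolding k_subsets_def by (rule n_subsets)

lemma k_subsetsD:
  assumes "finite \<Omega>" "S \<in> k_subsets \<Omega> k"
  shows "finite S" "S \<subseteq> \<Omega>" "card S = k"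
  using assms by (auto simp: k_subsets_def intro: finite_subset)

text \<open>
  The common step of the double counts below: after exchanging the order of summation, each
  \<open>f S\<close> is weighted by the number of ways in which \<open>S\<close> arises.
\<close>

lemma sum_incident_pairs:
  fixes f :: "'b \<Rightarrow> 'c::comm_semiring_1"
  assumes "finite A" "finite X"
  shows "(\<Sum>x\<in>A. \<Sum>S\<in>{S\<in>X. P x S}. f S) = (\<Sum>S\<in>X. of_nat (card {x\<in>A. P x S}) * f S)"
  by (subst sum.swap_restrict[OF assms]) simp

lemma sum_if_eq_meet_sum:
  assumes "finite \<Omega>"
  shows "(\<Sum>S\<in>k_subsets \<Omega> i. if card (S \<inter> T) = j then c * f S else 0) = c * meet_sum \<Omega> i f T j"
  unfolding meet_sum_def sum_distrib_left
  by (rule sum.inter_filter[symmetric]) (rule finite_k_subsets[OF assms])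

text \<open>
  Add up the harmonicity conditions at all \<open>(i - 1)\<close>-sets \<open>R\<close> with \<open>card (R \<inter> T) = j\<close>. A set \<open>S\<close> is
  obtained from such an \<open>R\<close> by inserting a point \<open>x\<close>. If \<open>card (S \<inter> T) = Suc j\<close>, then \<open>x\<close> is
  any of the \<open>Suc j\<close> points of \<open>S \<inter> T\<close>; if \<open>card (S \<inter> T) = j\<close>, it is any of the \<open>i - j\<close> points of
  \<open>S - T\<close>; no other \<open>S\<close> occurs.
\<close>

lemma meet_sum_recurrence:
  fixes f :: "'a set \<Rightarrow> 'b::comm_ring_1"
  assumes fin: "finite \<Omega>" and h: "harmonic \<Omega> i f" and j: "j < i"
  shows "of_nat (Suc j) * meet_sum \<Omega> i f T (Suc j) + of_nat (i - j) * meet_sum \<Omega> i f T j = 0"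
proof -
  let ?X = "k_subsets \<Omega> i"
  let ?B = "\<lambda>R. R \<subseteq> \<Omega> \<and> Suc (card R) = i \<and> card (R \<inter> T) = j"
  let ?c = "\<lambda>S. card {x\<in>\<Omega>. x \<in> S \<and> card ((S - {x}) \<inter> T) = j}"
  have finR: "finite {R. ?B R}"
    by (rule finite_subset[of _ "Pow \<Omega>"]) (use fin in auto)
  \<comment> \<open>The pair \<open>(R, x)\<close> corresponds to the pair \<open>(x, S)\<close> with \<open>S = insert x R\<close>.\<close>
  have "0 = (\<Sum>R | ?B R. \<Sum>x\<in>\<Omega> - R. f (insert x R))"
    using h by (simp add: harmonic_def)
  also have "\<dots> = (\<Sum>(R, x)\<in>(SIGMA R:{R. ?B R}. \<Omega> - R). f (insert x R))"
    using fin finR by (subst sum.Sigma) auto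
  also have "\<dots> = (\<Sum>(x, S)\<in>(SIGMA x:\<Omega>. {S\<in>?X. x \<in> S \<and> card ((S - {x}) \<inter> T) = j}). f S)"
  proof (rule sum.reindex_bij_witness[of _ "\<lambda>(x, S). (S - {x}, x)" "\<lambda>(R, x). (x, insert x R)"])
    fix a assume a: "a \<in> (SIGMA x:\<Omega>. {S\<in>?X. x \<in> S \<and> card ((S - {x}) \<inter> T) = j})"
    obtain x S where xS: "a = (x, S)" by (cases a)
    have "finite S" using a k_subsetsD(1)[OF fin, of S i] by (auto simp: xS)
    then show "(case a of (x, S) \<Rightarrow> (S - {x}, x)) \<in> (SIGMA R:{R. ?B R}. \<Omega> - R)"
      using a j by (auto simp: xS k_subsets_def card.remove[of S x])
  next
    fix a assume a: "a \<in> (SIGMA R:{R. ?B R}. \<Omega> - R)"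
    obtain R x where Rx: "a = (R, x)" by (cases a)
    have "finite R" using a Rx fin by (auto intro: finite_subset)
    then show "(case a of (R, x) \<Rightarrow> (x, insert x R))
        \<in> (SIGMA x:\<Omega>. {S\<in>?X. x \<in> S \<and> card ((S - {x}) \<inter> T) = j})"
      using a by (auto simp: Rx k_subsets_def)
  qed auto
  also have "\<dots> = (\<Sum>x\<in>\<Omega>. \<Sum>S\<in>{S\<in>?X. x \<in> S \<and> card ((S - {x}) \<inter> T) = j}. f S)"
    using fin by (subst sum.Sigma) (auto simp: finite_k_subsets)
  also have "\<dots> = (\<Sum>S\<in>?X. of_nat (?c S) * f S)"
    using fin by (intro sum_incident_pairs) (auto simp: finite_k_subsets)
  also have "\<dots> = (\<Sum>S\<in>?X. (if card (S \<inter> T) = Suc j then of_nat (Suc j) * f S else 0)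
                        + (if card (S \<inter> T) = j then of_nat (i - j) * f S else 0))"
  proof (rule sum.cong[OF refl])
    fix S assume S: "S \<in> ?X"
    have fS: "finite S" and S': "S \<subseteq> \<Omega>" "card S = i"
      by (fact k_subsetsD[OF fin S])+
    have in_T: "card ((S - {x}) \<inter> T) = card (S \<inter> T) - 1" if "x \<in> S \<inter> T" for x
    proof -
      have "(S - {x}) \<inter> T = (S \<inter> T) - {x}" by auto
      then show ?thesis using that fS by simp
    qed
    have out_T: "card ((S - {x}) \<inter> T) = card (S \<inter> T)" if "x \<in> S - T" for x
    proof -
      have "(S - {x}) \<inter> T = S \<inter> T" using that by auto
      then show ?thesis by simp
    qed
    have pos: "card (S \<inter> T) > 0" if "x \<in> S \<inter> T" for x
      using that fS by (auto simp: card_gt_0_iff)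
    have eq: "{x\<in>\<Omega>. x \<in> S \<and> card ((S - {x}) \<inter> T) = j}
        = (if card (S \<inter> T) = Suc j then S \<inter> T else if card (S \<inter> T) = j then S - T else {})"
    proof -
      have "x \<in> \<Omega> \<and> x \<in> S \<and> card ((S - {x}) \<inter> T) = j
          \<longleftrightarrow> x \<in> S \<inter> T \<and> card (S \<inter> T) = Suc j \<or> x \<in> S - T \<and> card (S \<inter> T) = j" for x
        using in_T[of x] out_T[of x] pos[of x] S'(1) by (cases "x \<in> S"; cases "x \<in> T") auto
      then show ?thesis by auto
    qed
    have "card (S - T) = i - card (S \<inter> T)"
      using fS S'(2) by (metis card_Diff_subset_Int finite_Int)
    then show "of_nat (?c S) * f S = (if card (S \<inter> T) = Suc j then of_nat (Suc j) * f S else 0)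
                        + (if card (S \<inter> T) = j then of_nat (i - j) * f S else 0)"
      unfolding eq by auto
  qed
  also have "\<dots> = of_nat (Suc j) * meet_sum \<Omega> i f T (Suc j) + of_nat (i - j) * meet_sum \<Omega> i f T j"
    by (simp only: sum.distrib sum_if_eq_meet_sum[OF fin])
  finally show ?thesis by simp
qed

lemma meet_sum_full:
  assumes "finite \<Omega>" "T \<subseteq> \<Omega>"
  shows "meet_sum \<Omega> i f T i = subset_sum i f T"
proof -
  have "{S \<in> k_subsets \<Omega> i. card (S \<inter> T) = i} = k_subsets T i"
  proof (intro equalityI subsetI)
    fix S assume S: "S \<in> {S \<in> k_subsets \<Omega> i. card (S \<inter> T) = i}"
    then have "finite S" using k_subsetsD(1)[OF assms(1)] by blast
    then have "S \<inter> T = S" using S by (intro card_subset_eq) (auto simp: k_subsets_def)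
    then show "S \<in> k_subsets T i" using S by (auto simp: k_subsets_def)
  next
    fix S assume S: "S \<in> k_subsets T i"
    then have "S \<inter> T = S" by (auto simp: k_subsets_def)
    with S assms(2) show "S \<in> {S \<in> k_subsets \<Omega> i. card (S \<inter> T) = i}" by (auto simp: k_subsets_def)
  qed
  then show ?thesis by (simp add: meet_sum_def subset_sum_def)
qed

lemma meet_sum_empty:
  assumes "finite \<Omega>"
  shows "meet_sum \<Omega> i f T 0 = subset_sum i f (\<Omega> - T)"
proof -
  have "{S \<in> k_subsets \<Omega> i. card (S \<inter> T) = 0} = k_subsets (\<Omega> - T) i"
    using assms by (auto simp: k_subsets_def card_eq_0_iff dest: finite_subset)
  then show ?thesis by (simp add: meet_sum_def subset_sum_def)
qed

text \<open>
  The recurrence is first order, so it determines all the sums from the one with \<open>j = 0\<close>; the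
  binomial coefficients satisfy the same recurrence up to the sign.
\<close>

lemma harmonic_meet_sum:
  fixes f :: "'a set \<Rightarrow> 'b::field_char_0"
  assumes fin: "finite \<Omega>" and h: "harmonic \<Omega> i f"
  shows "j \<le> i \<Longrightarrow> meet_sum \<Omega> i f T j = (-1) ^ j * of_nat (i choose j) * meet_sum \<Omega> i f T 0"
proof (induction j)
  case (Suc j)
  let ?a = "meet_sum \<Omega> i f T"
  have binom: "of_nat (Suc j) * of_nat (i choose Suc j) = (of_nat (i - j) * of_nat (i choose j) :: 'b)"
    unfolding of_nat_mult[symmetric] by (simp only: binomial_absorption binomial_absorb_comp)
  have "of_nat (Suc j) * ?a (Suc j) = - (of_nat (i - j) * ?a j)"
    using meet_sum_recurrence[OF fin h, of j T] Suc.prems by (simp add: eq_neg_iff_add_eq_0)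
  also have "\<dots> = - ((-1) ^ j * (of_nat (i - j) * of_nat (i choose j)) * ?a 0)"
    using Suc by simp
  also have "\<dots> = of_nat (Suc j) * ((-1) ^ Suc j * of_nat (i choose Suc j) * ?a 0)"
    unfolding binom[symmetric] by (simp add: algebra_simps)
  finally show ?case
    by (simp only: mult_cancel_left of_nat_eq_0_iff) simp
qed simp

text \<open>
  This is where the summand \<open>(-1)^i\<close> of the eigenvalue comes from: complementation acts on
  lifts of harmonic functions as a sign, by comparing \<open>j = i\<close> with \<open>j = 0\<close>.
\<close>

lemma subset_sum_compl:
  fixes f :: "'a set \<Rightarrow> 'b::field_char_0"
  assumes fin: "finite \<Omega>" and h: "harmonic \<Omega> i f" and T: "T \<subseteq> \<Omega>"
  shows "subset_sum i f (\<Omega> - T) = (-1) ^ i * subset_sum i f T"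
proof -
  have "subset_sum i f T = (-1) ^ i * subset_sum i f (\<Omega> - T)"
    using harmonic_meet_sum[OF fin h order_refl, of T]
    by (simp add: meet_sum_full[OF fin T] meet_sum_empty[OF fin])
  then show ?thesis by (cases "even i") simp_all
qed

section \<open>Lifts of harmonic functions and the Johnson graph\<close>

text \<open>
  An \<open>i\<close>-set contained in \<open>R\<close> lies in \<open>insert y R\<close> for every \<open>y\<close>, and one that misses \<open>R\<close> by a
  single point lies in it for exactly one \<open>y\<close>. The recurrence for \<open>T = R\<close> and \<open>j = i - 1\<close> turns the
  contribution of the second kind into \<open>- i\<close> times the lift.
\<close>

lemma sum_subset_sum_insert:
  fixes f :: "'a set \<Rightarrow> 'b::comm_ring_1"
  assumes fin: "finite \<Omega>" and h: "harmonic \<Omega> i f" and R: "R \<subseteq> \<Omega>"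
  shows "(\<Sum>y\<in>\<Omega> - R. subset_sum i f (insert y R))
       = (of_nat (card \<Omega>) - of_nat (card R) - of_nat i) * subset_sum i f R"
proof -
  let ?X = "k_subsets \<Omega> i"
  let ?n = "card (\<Omega> - R)"
  have "(\<Sum>y\<in>\<Omega> - R. subset_sum i f (insert y R)) = (\<Sum>y\<in>\<Omega> - R. \<Sum>S\<in>{S\<in>?X. S \<subseteq> insert y R}. f S)"
    unfolding subset_sum_def using R by (intro sum.cong) (auto simp: k_subsets_def)
  also have "\<dots> = (\<Sum>S\<in>?X. of_nat (card {y\<in>\<Omega> - R. S \<subseteq> insert y R}) * f S)"
    using fin by (intro sum_incident_pairs) (auto simp: finite_k_subsets)
  also have "\<dots> = (\<Sum>S\<in>?X. (if card (S \<inter> R) = i then of_nat ?n * f S else 0)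
                        + (if Suc (card (S \<inter> R)) = i then f S else 0))"
  proof (rule sum.cong[OF refl])
    fix S assume S: "S \<in> ?X"
    have fS: "finite S" and S': "S \<subseteq> \<Omega>" "card S = i"
      by (fact k_subsetsD[OF fin S])+
    have card_diff: "card (S \<inter> R) + card (S - R) = i"
      using fS S'(2) card_Int_Diff[of S R] by simp
    have fSR: "finite (S - R)" using fS by simp
    consider "S - R = {}" | z where "S - R = {z}" | "card (S - R) \<ge> 2"
    proof -
      have "card (S - R) = 0 \<or> card (S - R) = 1 \<or> card (S - R) \<ge> 2" by linarith
      then show thesis using that fSR by (auto simp: card_1_singleton_iff)
    qed
    then show "of_nat (card {y\<in>\<Omega> - R. S \<subseteq> insert y R}) * f S
        = (if card (S \<inter> R) = i then of_nat ?n * f S else 0)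
          + (if Suc (card (S \<inter> R)) = i then f S else 0)"
    proof cases
      case 1
      then have "{y\<in>\<Omega> - R. S \<subseteq> insert y R} = \<Omega> - R" by auto
      then show ?thesis using card_diff 1 by auto
    next
      case 2
      then have "{y\<in>\<Omega> - R. S \<subseteq> insert y R} = {z}" using S' by auto
      then show ?thesis using card_diff 2 by auto
    next
      case 3
      have "\<not> S \<subseteq> insert y R" for y
      proof
        assume "S \<subseteq> insert y R"
        then have "card (S - R) \<le> card {y}" by (intro card_mono) auto
        then show False using 3 by simp
      qed
      then show ?thesis using card_diff 3 by auto
    qed
  qed
  also have "\<dots> = of_nat ?n * meet_sum \<Omega> i f R i + (if i = 0 then 0 else meet_sum \<Omega> i f R (i - 1))"
    by (cases i) (simp_all add: sum.distrib sum_if_eq_meet_sum[OF fin]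
        sum_if_eq_meet_sum[OF fin, where c = 1, unfolded mult_1])
  also have "(if i = 0 then 0 else meet_sum \<Omega> i f R (i - 1)) = - (of_nat i * meet_sum \<Omega> i f R i)"
    using meet_sum_recurrence[OF fin h, of "i - 1" R]
    by (cases i) (simp_all add: eq_neg_iff_add_eq_0 add.commute)
  also have "of_nat ?n = (of_nat (card \<Omega>) - of_nat (card R) :: 'b)"
    using fin R by (simp add: card_Diff_subset finite_subset card_mono of_nat_diff)
  finally show ?thesis
    using meet_sum_full[OF fin R, of i f] by (simp add: algebra_simps)
qed

lemma sum_subset_sum_remove:
  fixes f :: "'a set \<Rightarrow> 'b::comm_ring_1"
  assumes fin: "finite T"
  shows "(\<Sum>x\<in>T. subset_sum i f (T - {x})) = (of_nat (card T) - of_nat i) * subset_sum i f T"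
proof -
  have "(\<Sum>x\<in>T. subset_sum i f (T - {x})) = (\<Sum>x\<in>T. \<Sum>S\<in>{S\<in>k_subsets T i. x \<notin> S}. f S)"
    unfolding subset_sum_def by (intro sum.cong) (auto simp: k_subsets_def)
  also have "\<dots> = (\<Sum>S\<in>k_subsets T i. of_nat (card {x\<in>T. x \<notin> S}) * f S)"
    using fin by (intro sum_incident_pairs) (auto simp: finite_k_subsets)
  also have "\<dots> = (\<Sum>S\<in>k_subsets T i. (of_nat (card T) - of_nat i) * f S)"
  proof (rule sum.cong[OF refl])
    fix S assume "S \<in> k_subsets T i"
    then have S: "S \<subseteq> T" "card S = i" by (auto simp: k_subsets_def)
    have "{x\<in>T. x \<notin> S} = T - S" by auto
    then show "of_nat (card {x\<in>T. x \<notin> S}) * f S = (of_nat (card T) - of_nat i) * f S"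
      using S fin card_mono[OF fin S(1)]
      by (simp add: card_Diff_subset finite_subset of_nat_diff)
  qed
  finally show ?thesis by (simp add: subset_sum_def sum_distrib_left)
qed

lemma johnson_neighbour_sum:
  fixes g :: "'a set \<Rightarrow> 'b::comm_ring_1"
  assumes fin: "finite \<Omega>" and T: "T \<in> k_subsets \<Omega> m" and m: "m \<ge> 1"
  shows "(\<Sum>T'\<in>{T' \<in> k_subsets \<Omega> m. card (T \<inter> T') = m - 1}. g T')
       = (\<Sum>x\<in>T. \<Sum>y\<in>\<Omega> - T. g (insert y (T - {x})))"
proof -
  let ?h = "\<lambda>(x, y). insert y (T - {x})"
  have fT: "finite T" and T': "T \<subseteq> \<Omega>" "card T = m"
    by (fact k_subsetsD[OF fin T])+
  have inj: "inj_on ?h (T \<times> (\<Omega> - T))"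
  proof (rule inj_onI, clarify)
    fix x y x' y' assume *: "x \<in> T" "y \<notin> T" "x' \<in> T" "y' \<notin> T"
      and eq: "insert y (T - {x}) = insert y' (T - {x'})"
    have "{x} = T - insert y (T - {x})" "{x'} = T - insert y' (T - {x'})"
      "{y} = insert y (T - {x}) - T" "{y'} = insert y' (T - {x'}) - T"
      using * by auto
    then show "x = x' \<and> y = y'" unfolding eq by (metis singleton_inject)
  qed
  have "?h ` (T \<times> (\<Omega> - T)) = {T' \<in> k_subsets \<Omega> m. card (T \<inter> T') = m - 1}"
  proof (intro equalityI subsetI)
    fix U assume "U \<in> ?h ` (T \<times> (\<Omega> - T))"
    then obtain x y where xy: "x \<in> T" "y \<in> \<Omega> - T" "U = insert y (T - {x})" by auto
    have "T \<inter> U = T - {x}" using xy by auto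
    then show "U \<in> {T' \<in> k_subsets \<Omega> m. card (T \<inter> T') = m - 1}"
      using xy fT T' m by (auto simp: k_subsets_def)
  next
    fix U assume U: "U \<in> {T' \<in> k_subsets \<Omega> m. card (T \<inter> T') = m - 1}"
    then have fU: "finite U" using k_subsetsD(1)[OF fin] by blast
    have "card (T - U) = 1" "card (U - T) = 1"
      using U fT fU T'(2) m card_Int_Diff[of T U] card_Int_Diff[of U T]
      by (auto simp: k_subsets_def Int_commute)
    then obtain x y where xy: "T - U = {x}" "U - T = {y}" by (auto simp: card_1_singleton_iff)
    then have "U = insert y (T - {x})" "x \<in> T" "y \<in> \<Omega> - T"
      using U by (auto simp: k_subsets_def)
    then show "U \<in> ?h ` (T \<times> (\<Omega> - T))" by force
  qed
  then have "(\<Sum>T'\<in>{T' \<in> k_subsets \<Omega> m. card (T \<inter> T') = m - 1}. g T') = (\<Sum>p\<in>T \<times> (\<Omega> - T). g (?h p))"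
    using sum.reindex[OF inj, of g] by (simp add: o_def)
  also have "\<dots> = (\<Sum>x\<in>T. \<Sum>y\<in>\<Omega> - T. g (insert y (T - {x})))"
    by (subst sum.cartesian_product) (simp add: case_prod_unfold)
  finally show ?thesis .
qed

text \<open>
  A neighbour of \<open>T\<close> is reached by removing a point \<open>x\<close> and inserting another point \<open>y\<close>.
  Allowing also \<open>y = x\<close>, which adds \<open>T\<close> itself once for each \<open>x \<in> T\<close>, makes this the composition of
  the two steps above, and each of them multiplies the lift by a scalar.
\<close>

lemma subset_sum_johnson:
  fixes f :: "'a set \<Rightarrow> 'b::comm_ring_1"
  assumes fin: "finite \<Omega>" and h: "harmonic \<Omega> i f" and T: "T \<in> k_subsets \<Omega> m" and m: "m \<ge> 1"
  shows "(\<Sum>T'\<in>{T' \<in> k_subsets \<Omega> m. card (T \<inter> T') = m - 1}. subset_sum i f T')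
       = ((of_nat m - of_nat i) * (of_nat (card \<Omega>) - of_nat m - of_nat i) - of_nat i) * subset_sum i f T"
proof -
  let ?F = "subset_sum i f"
  let ?c = "of_nat (card \<Omega>) - of_nat m + 1 - of_nat i :: 'b"
  have fT: "finite T" and T': "T \<subseteq> \<Omega>" "card T = m"
    by (fact k_subsetsD[OF fin T])+
  have inner: "(\<Sum>y\<in>\<Omega> - T. ?F (insert y (T - {x}))) = ?c * ?F (T - {x}) - ?F T" if x: "x \<in> T" for x
  proof -
    have "\<Omega> - (T - {x}) = insert x (\<Omega> - T)" using x T' by auto
    then have "(\<Sum>y\<in>\<Omega> - (T - {x}). ?F (insert y (T - {x}))) = ?F T + (\<Sum>y\<in>\<Omega> - T. ?F (insert y (T - {x})))"
      using x fin by (simp add: insert_absorb)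
    moreover have "of_nat (card (T - {x})) = (of_nat m - 1 :: 'b)"
      using x fT T' m by (simp add: of_nat_diff)
    moreover have "T - {x} \<subseteq> \<Omega>" using T' by auto
    ultimately show ?thesis
      using sum_subset_sum_insert[OF fin h, of "T - {x}"] by (simp add: algebra_simps)
  qed
  have "(\<Sum>T'\<in>{T' \<in> k_subsets \<Omega> m. card (T \<inter> T') = m - 1}. ?F T')
      = (\<Sum>x\<in>T. ?c * ?F (T - {x}) - ?F T)"
    unfolding johnson_neighbour_sum[OF fin T m] by (rule sum.cong) (simp_all add: inner)
  also have "\<dots> = ?c * (\<Sum>x\<in>T. ?F (T - {x})) - of_nat m * ?F T"
    by (simp add: sum_subtractf sum_distrib_left T')
  also have "\<dots> = (?c * (of_nat m - of_nat i) - of_nat m) * ?F T"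
    by (simp add: sum_subset_sum_remove[OF fT] T' algebra_simps)
  finally show ?thesis by (simp add: algebra_simps)
qed

text \<open>
  If the lift vanishes on \<open>Suc k\<close>-sets, then it vanishes on \<open>k\<close>-sets as long as the scalar
  \<open>card \<Omega> - k - i\<close> in the insertion step is nonzero. Descending to \<open>k = i\<close> recovers \<open>f\<close>
  itself.
\<close>

lemma harmonic_eq_0_if_subset_sum_eq_0:
  fixes f :: "'a set \<Rightarrow> 'b::field_char_0"
  assumes fin: "finite \<Omega>" and h: "harmonic \<Omega> i f"
    and "i \<le> k" "k + i \<le> card \<Omega>"
    and "\<And>T. T \<in> k_subsets \<Omega> k \<Longrightarrow> subset_sum i f T = 0"
    and S: "S \<in> k_subsets \<Omega> i"
  shows "f S = 0"
  using assms(3-5)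
proof (induction k rule: dec_induct)
  case base
  have "k_subsets S i = {S}"
    using k_subsetsD[OF fin S] by (auto simp: k_subsets_def dest: card_subset_eq)
  then show ?case using base(2)[OF S] by (simp add: subset_sum_def)
next
  case (step k)
  show ?case
  proof (rule step.IH)
    fix R assume R: "R \<in> k_subsets \<Omega> k"
    have R': "R \<subseteq> \<Omega>" "card R = k" "finite R"
      by (fact k_subsetsD[OF fin R])+
    have "insert y R \<in> k_subsets \<Omega> (Suc k)" if "y \<in> \<Omega> - R" for y
      using that R' by (auto simp: k_subsets_def)
    then have "(of_nat (card \<Omega>) - of_nat k - of_nat i) * subset_sum i f R = 0"
      using sum_subset_sum_insert[OF fin h R'(1)] step.prems(2) R'(2) by simp
    moreover have "of_nat (card \<Omega>) - of_nat k - of_nat i = (of_nat (card \<Omega> - k - i) :: 'b)"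
      using step.prems(1) by (simp add: of_nat_diff)
    moreover have "card \<Omega> - k - i \<noteq> 0" using step.prems(1) by simp
    ultimately show "subset_sum i f R = 0" by (simp only: mult_eq_0_iff of_nat_eq_0_iff) simp
  qed (use step.prems(1) in simp)
qed

section \<open>Kernel dimensions and algebraic multiplicities\<close>

text \<open>Row reduction leaves at most one pivot in each of the \<open>r\<close> rows.\<close>

lemma kernel_dim_ge:
  fixes D :: "'a::field mat"
  assumes D: "D \<in> carrier_mat r c"
  shows "c - r \<le> kernel_dim D"
proof -
  obtain P where P: "P \<in> carrier_mat r r" "gauss_jordan_single D = P * D" 
    "gauss_jordan_single D \<in> carrier_mat r c" "row_echelon_form (gauss_jordan_single D)"
    using gauss_jordan_single[OF D refl] by auto
  let ?p = "card {i. i < r \<and> row (gauss_jordan_single D) i \<noteq> 0\<^sub>v c}"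
  have "?p \<le> card {..<r}" by (rule card_mono) auto
  moreover have "kernel_dim D = c - ?p"
    using kernel_dim_code[of D] find_base_vectors(5)[OF P(4,3)] D by simp
  ultimately show ?thesis by simp
qed

text \<open>
  An injective linear map sends a basis to a linearly independent set, whose size is bounded by
  the dimension of the target.
\<close>

lemma kernel_dim_mono_injective:
  fixes D W M :: "'a::field mat"
  assumes D: "D \<in> carrier_mat r c" and W: "W \<in> carrier_mat n c" and M: "M \<in> carrier_mat l n"
    and into: "\<And>v. v \<in> mat_kernel D \<Longrightarrow> W *\<^sub>v v \<in> mat_kernel M"
    and inj: "\<And>v. v \<in> mat_kernel D \<Longrightarrow> W *\<^sub>v v = 0\<^sub>v n \<Longrightarrow> v = 0\<^sub>v c"
  shows "kernel_dim D \<le> kernel_dim M"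
proof -
  interpret D: kernel r c D by unfold_locales (rule D)
  interpret M: kernel l n M by unfold_locales (rule M)
  have hom: "(*\<^sub>v) W \<in> LinearCombinations.module_hom class_ring D.VK M.VK"
    unfolding LinearCombinations.module_hom_def
    using into mat_kernelD(1)[OF D] W
    by (auto simp: module_vec_simps mult_add_distrib_mat_vec[OF W] mult_mat_vec[OF W])
  interpret T: linear_map class_ring D.VK M.VK "(*\<^sub>v) W"
    by unfold_locales (rule hom)
  have fin: "M.Ker.fin_dim"
    using kernel_basis_exists[OF M] unfolding M.Ker.fin_dim_def M.Ker.basis_def by auto
  have inj_on: "inj_on ((*\<^sub>v) W) (mat_kernel D)"
  proof (rule inj_onI)
    fix v w assume vw: "v \<in> mat_kernel D" "w \<in> mat_kernel D" "W *\<^sub>v v = W *\<^sub>v w"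
    note v = mat_kernelD[OF D vw(1)] and w = mat_kernelD[OF D vw(2)]
    have "v - w \<in> mat_kernel D"
      using v w by (intro mat_kernelI[OF D]) (auto simp: mult_minus_distrib_mat_vec[OF D])
    moreover have "W *\<^sub>v (v - w) = 0\<^sub>v n"
      using v w vw(3) W by (simp add: mult_minus_distrib_mat_vec[OF W] minus_cancel_vec)
    ultimately have "v - w = 0\<^sub>v c" by (rule inj)
    then show "v = w" using v(1) w(1)
      by (metis eq_iff_diff_eq_0 carrier_vecD eq_vecI index_minus_vec(1) index_zero_vec(1))
  qed
  obtain B where B: "finite B" "D.Ker.basis B"
    using kernel_basis_exists[OF D] by auto
  then have BD: "B \<subseteq> mat_kernel D" and li: "D.Ker.lin_indpt B"
    by (auto simp: D.Ker.basis_def)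
  have BM: "(*\<^sub>v) W ` B \<subseteq> mat_kernel M" using BD into by auto
  have "M.Ker.lin_indpt ((*\<^sub>v) W ` B)"
  proof (rule M.Ker.finite_lin_indpt2)
    fix a assume "M.Ker.lincomb a ((*\<^sub>v) W ` B) = 0\<^sub>v n"
    then have "W *\<^sub>v D.Ker.lincomb (a \<circ> (*\<^sub>v) W) B = 0\<^sub>v n"
      using T.lincomb_linear_image[of B a] inj_on BD B(1) by simp
    then have "D.Ker.lincomb (a \<circ> (*\<^sub>v) W) B = 0\<^sub>v c"
      using inj D.Ker.lincomb_closed[OF BD] by simp
    then show "\<forall>v\<in>(*\<^sub>v) W ` B. a v = 0"
      using D.Ker.lin_dep_crit[OF B(1) subset_refl, of "a \<circ> (*\<^sub>v) W"] li by auto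
  qed (use B BM in auto)
  then have "card ((*\<^sub>v) W ` B) \<le> M.Ker.dim"
    using M.Ker.li_le_dim(2)[OF fin] BM by simp
  moreover have "card ((*\<^sub>v) W ` B) = card B"
    using inj_on BD by (intro card_image) (rule inj_on_subset)
  ultimately show ?thesis
    using D.Ker.dim_basis[OF B] by simp
qed

text \<open>
  In the Jordan normal form, the geometric multiplicity counts the blocks of an eigenvalue and
  the algebraic multiplicity adds up their sizes.
\<close>

lemma kernel_dim_char_matrix_le_order:
  fixes A :: "complex mat"
  assumes A: "A \<in> carrier_mat n n"
  shows "kernel_dim (char_matrix A e) \<le> Polynomial.order e (char_poly A)"
proof -
  obtain as where "char_poly A = (\<Prod>a\<leftarrow>as. [:- a, 1:])"
    using char_poly_factorized[OF A] by blast
  then obtain n_as where jnf: "jordan_nf A n_as"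
    using jordan_nf_exists[OF A] by blast
  have "kernel_dim (char_matrix A e) = dim_gen_eigenspace A e 1"
    using A by (simp add: dim_gen_eigenspace_def)
  also have "\<dots> = (\<Sum>k\<leftarrow>map fst [(k, a)\<leftarrow>n_as. a = e]. min 1 k)"
    by (rule dim_gen_eigenspace[OF jnf])
  also have "\<dots> \<le> sum_list (map fst (filter (\<lambda>na. snd na = e) n_as))"
    by (induction n_as) auto
  also have "\<dots> = Polynomial.order e (char_poly A)"
    by (rule jordan_nf_order[OF jnf, symmetric])
  finally show ?thesis .
qed

lemma char_matrix_mult_eq_0:
  fixes A :: "'a::field mat"
  assumes A: "A \<in> carrier_mat n n" and v: "v \<in> carrier_vec n" and Av: "A *\<^sub>v v = e \<cdot>\<^sub>v v"
  shows "char_matrix A e *\<^sub>v v = 0\<^sub>v n"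
proof (cases "v = 0\<^sub>v n")
  case False
  then have "eigenvector A v e" using assms by (simp add: eigenvector_def)
  then show ?thesis by (simp add: eigenvector_char_matrix[OF A])
next
  case True
  have "char_matrix A e \<in> carrier_mat n n" using A by simp
  then have "char_matrix A e *\<^sub>v 0\<^sub>v n = 0\<^sub>v n" by (intro eq_vecI) auto
  then show ?thesis using True by simp
qed

text \<open>
  The orders of all the roots add up to at most the degree. When lower bounds at distinct points
  already add up to the degree, none of them can be strict and no further root is possible.
\<close>

lemma order_eq_if_lower_bounds_exhaust_degree:
  fixes p :: "'a::idom poly"
  assumes "p \<noteq> 0" and fin: "finite I" and inj: "inj_on \<theta> I"
    and pos: "\<And>i. i \<in> I \<Longrightarrow> 0 < d i"
    and le: "\<And>i. i \<in> I \<Longrightarrow> d i \<le> Polynomial.order (\<theta> i) p"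
    and total: "(\<Sum>i\<in>I. d i) = degree p"
  shows "{x. poly p x = 0} = \<theta> ` I" and "i \<in> I \<Longrightarrow> Polynomial.order (\<theta> i) p = d i"
proof -
  let ?Z = "{x. poly p x = 0}" and ?o = "\<lambda>x. Polynomial.order x p"
  have finZ: "finite ?Z" using \<open>p \<noteq> 0\<close> by (rule poly_roots_finite)
  have sub: "\<theta> ` I \<subseteq> ?Z"
    using pos le \<open>p \<noteq> 0\<close> by (force simp: order_root)
  have "sum ?o ?Z \<le> (\<Sum>i\<in>I. d i)"
    using sum_order_le_degree[OF \<open>p \<noteq> 0\<close>] total by simp
  moreover have "sum ?o ?Z = sum ?o (?Z - \<theta> ` I) + (\<Sum>i\<in>I. ?o (\<theta> i))"
    using sum.subset_diff[OF sub finZ, of ?o] by (simp add: sum.reindex[OF inj])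
  moreover have ge: "(\<Sum>i\<in>I. d i) \<le> (\<Sum>i\<in>I. ?o (\<theta> i))"
    by (rule sum_mono) (rule le)
  ultimately have rest: "sum ?o (?Z - \<theta> ` I) = 0" and eq: "(\<Sum>i\<in>I. ?o (\<theta> i)) = (\<Sum>i\<in>I. d i)"
    by linarith+
  have "?Z - \<theta> ` I = {}"
  proof -
    have "\<forall>x\<in>?Z - \<theta> ` I. ?o x = 0" using rest finZ by simp
    then show ?thesis using \<open>p \<noteq> 0\<close> order_root[of p] by blast
  qed
  then show "?Z = \<theta> ` I" using sub by blast
  show "?o (\<theta> i) = d i" if "i \<in> I"
    using sum_mono_inv[OF eq[symmetric] le that fin] by simp
qed

section \<open>Matrices of relations between finite sets\<close>

text \<open>
  Adjacency matrices and inclusion matrices are both of this form, and vectors are written as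
  functions evaluated along the same enumerations, so that products of matrices and vectors
  become sums over sets that do not mention indices.
\<close>

definition relation_matrix :: "('a \<Rightarrow> 'b \<Rightarrow> bool) \<Rightarrow> 'a list \<Rightarrow> 'b list \<Rightarrow> 'c::comm_ring_1 mat" where
  "relation_matrix P rs cs =
     mat (length rs) (length cs) (\<lambda>(a, b). if P (rs ! a) (cs ! b) then 1 else 0)"

definition vec_of_fun :: "'a list \<Rightarrow> ('a \<Rightarrow> 'b) \<Rightarrow> 'b vec" where
  "vec_of_fun xs f = vec (length xs) (\<lambda>a. f (xs ! a))"

lemma relation_matrix_carrier [simp]:
  "relation_matrix P rs cs \<in> carrier_mat (length rs) (length cs)"
  by (simp add: relation_matrix_def)

lemma vec_of_fun_carrier [simp]: "vec_of_fun xs f \<in> carrier_vec (length xs)"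
  by (simp add: vec_of_fun_def)

lemma vec_of_fun_eq_iff: "vec_of_fun xs f = vec_of_fun xs g \<longleftrightarrow> (\<forall>x\<in>set xs. f x = g x)"
  by (auto simp: vec_of_fun_def vec_eq_iff all_set_conv_all_nth)

lemma vec_of_fun_0: "0\<^sub>v (length xs) = vec_of_fun xs (\<lambda>_. 0)"
  by (auto simp: vec_of_fun_def)

lemma vec_of_fun_surj:
  assumes "distinct xs" "v \<in> carrier_vec (length xs)"
  obtains f where "v = vec_of_fun xs f"
proof
  have "inj_on ((!) xs) {..<length xs}"
    using assms(1) by (simp add: inj_on_nth)
  then show "v = vec_of_fun xs (\<lambda>x. v $ the_inv_into {..<length xs} ((!) xs) x)"
    using assms(2) by (auto simp: vec_of_fun_def vec_eq_iff the_inv_into_f_f)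
qed

lemma relation_matrix_mult_vec_of_fun:
  fixes f :: "'b \<Rightarrow> 'c::comm_ring_1"
  assumes "distinct cs"
  shows "relation_matrix P rs cs *\<^sub>v vec_of_fun cs f
       = vec_of_fun rs (\<lambda>R. \<Sum>S\<in>{S \<in> set cs. P R S}. f S)"
proof (rule eq_vecI)
  fix a assume "a < dim_vec (vec_of_fun rs (\<lambda>R. \<Sum>S\<in>{S \<in> set cs. P R S}. f S))"
  then have a: "a < length rs" by (simp add: vec_of_fun_def)
  have "(relation_matrix P rs cs *\<^sub>v vec_of_fun cs f) $ a
      = (\<Sum>b<length cs. if P (rs ! a) (cs ! b) then f (cs ! b) else 0)"
    using a by (simp add: relation_matrix_def vec_of_fun_def scalar_prod_def lessThan_atLeast0 if_distrib
        cong: if_cong) (auto intro!: sum.cong)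
  also have "\<dots> = (\<Sum>S\<in>set cs. if P (rs ! a) S then f S else 0)"
    by (rule sum.reindex_bij_betw[OF bij_betw_nth]) (use assms in auto)
  finally show "(relation_matrix P rs cs *\<^sub>v vec_of_fun cs f) $ a
      = vec_of_fun rs (\<lambda>R. \<Sum>S\<in>{S \<in> set cs. P R S}. f S) $ a"
    using a by (simp add: vec_of_fun_def sum.inter_filter)
qed (simp add: relation_matrix_def vec_of_fun_def)

section \<open>Eigenspaces of the enhanced Johnson graph\<close>

lemma sum_supersets:
  fixes f :: "'a set \<Rightarrow> 'b::comm_ring_1"
  assumes fin: "finite \<Omega>" and R: "R \<subseteq> \<Omega>" "Suc (card R) = i"
  shows "(\<Sum>S\<in>{S \<in> k_subsets \<Omega> i. R \<subseteq> S}. f S) = (\<Sum>x\<in>\<Omega> - R. f (insert x R))"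
proof -
  have fR: "finite R" using fin R(1) by (rule rev_finite_subset)
  have "inj_on (\<lambda>x. insert x R) (\<Omega> - R)" by (auto simp: inj_on_def)
  moreover have "(\<lambda>x. insert x R) ` (\<Omega> - R) = {S \<in> k_subsets \<Omega> i. R \<subseteq> S}"
  proof (intro equalityI subsetI)
    fix S assume "S \<in> (\<lambda>x. insert x R) ` (\<Omega> - R)"
    then show "S \<in> {S \<in> k_subsets \<Omega> i. R \<subseteq> S}"
      using R fR by (auto simp: k_subsets_def)
  next
    fix S assume S: "S \<in> {S \<in> k_subsets \<Omega> i. R \<subseteq> S}"
    then have "S \<subseteq> \<Omega>" "card S = i" "R \<subseteq> S" by (auto simp: k_subsets_def)
    then have "card (S - R) = 1" using R fR by (simp add: card_Diff_subset)
    then obtain x where x: "S - R = {x}" by (auto simp: card_1_singleton_iff)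
    then have "S = insert x R" "x \<in> \<Omega> - R" using \<open>R \<subseteq> S\<close> \<open>S \<subseteq> \<Omega>\<close> by auto
    then show "S \<in> (\<lambda>x. insert x R) ` (\<Omega> - R)" by blast
  qed
  ultimately show ?thesis
    using sum.reindex[of "\<lambda>x. insert x R" "\<Omega> - R" f] by (simp add: o_def)
qed

lemma pverts_enhanced_johnson_graph: "pverts (enhanced_johnson_graph m) = k_subsets {1..2 * m} m"
  by (simp add: enhanced_johnson_graph_def johnson_graph_def k_subsets_def)

lemma enhanced_johnson_neighbours:
  assumes "T \<in> k_subsets {1..2 * m} m"
  shows "{T' \<in> k_subsets {1..2 * m} m. (T, T') \<in> parcs (enhanced_johnson_graph m)}
       = {T' \<in> k_subsets {1..2 * m} m. card (T \<inter> T') = m - 1} \<union> {{1..2 * m} - T}"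
  using assms compl_in_johnson_verts[of T m]
  by (auto simp: enhanced_johnson_graph_def johnson_graph_def k_subsets_def Let_def)

text \<open>
  The complement of \<open>T\<close> meets \<open>T\<close> in \<open>0\<close> points, and \<open>m - 1 > 0\<close>; hence it is a new neighbour,
  and its contribution \<open>(-1)^i\<close> is simply added to the one of the Johnson graph.
\<close>

lemma enhanced_johnson_neighbour_sum:
  fixes f :: "nat set \<Rightarrow> complex"
  assumes h: "harmonic {1..2 * m} i f" and m: "m \<ge> 2" and T: "T \<in> k_subsets {1..2 * m} m"
  shows "(\<Sum>T'\<in>{T' \<in> k_subsets {1..2 * m} m. (T, T') \<in> parcs (enhanced_johnson_graph m)}. subset_sum i f T')
       = of_int (enhanced_johnson_eigenvalue m i) * subset_sum i f T"
proof -
  let ?\<Omega> = "{1..2 * m}"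
  let ?N = "{T' \<in> k_subsets ?\<Omega> m. card (T \<inter> T') = m - 1}"
  have fin: "finite ?\<Omega>" by simp
  have "T \<inter> (?\<Omega> - T) = {}" by auto
  then have "?\<Omega> - T \<notin> ?N" using m by auto
  then have "(\<Sum>T'\<in>?N \<union> {?\<Omega> - T}. subset_sum i f T')
      = subset_sum i f (?\<Omega> - T) + (\<Sum>T'\<in>?N. subset_sum i f T')"
    by (simp add: finite_k_subsets)
  also have "subset_sum i f (?\<Omega> - T) = (-1) ^ i * subset_sum i f T"
    using subset_sum_compl[OF fin h] k_subsetsD(2)[OF fin T] by blast
  also have "(\<Sum>T'\<in>?N. subset_sum i f T')
      = ((of_nat m - of_nat i) * (of_nat m - of_nat i) - of_nat i) * subset_sum i f T"
    using subset_sum_johnson[OF fin h T] m by simp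
  finally show ?thesis
    unfolding enhanced_johnson_neighbours[OF T]
    by (simp add: enhanced_johnson_eigenvalue_def johnson_eigenvalue_def power2_eq_square algebra_simps)
qed

text \<open>
  Let \<open>D\<close> be the inclusion matrix of \<open>(i - 1)\<close>-sets in \<open>i\<close>-sets and \<open>W\<close> the one of \<open>i\<close>-sets in
  \<open>m\<close>-sets. The kernel of \<open>D\<close> consists of the harmonic functions, so its dimension is at least
  the difference of the two binomial coefficients, and \<open>W\<close> embeds it into the eigenspace.
\<close>

lemma enhanced_johnson_order_ge:
  fixes A :: "complex mat"
  assumes m: "m \<ge> 2" and i: "i \<le> m"
    and vs: "distinct vs" "set vs = pverts (enhanced_johnson_graph m)"
    and A: "A = adjacency_matrix (enhanced_johnson_graph m) vs"
  shows "nat (enhanced_johnson_multiplicity m i)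
       \<le> Polynomial.order (of_int (enhanced_johnson_eigenvalue m i)) (char_poly A)"
proof -
  let ?\<Omega> = "{1..2 * m}" and ?G = "enhanced_johnson_graph m"
  let ?\<theta> = "of_int (enhanced_johnson_eigenvalue m i) :: complex"
  let ?L = "{R. R \<subseteq> ?\<Omega> \<and> Suc (card R) = i}"
  have fin: "finite ?\<Omega>" by simp
  have finL: "finite ?L" by (rule finite_subset[of _ "Pow ?\<Omega>"]) auto
  obtain cs where cs: "set cs = k_subsets ?\<Omega> i" "distinct cs"
    using finite_distinct_list[OF finite_k_subsets[OF fin]] by metis
  obtain rs where rs: "set rs = ?L" "distinct rs"
    using finite_distinct_list[OF finL] by metis
  have vs': "set vs = k_subsets ?\<Omega> m"
    using vs(2) by (simp add: pverts_enhanced_johnson_graph)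
  define D :: "complex mat" where "D = relation_matrix (\<subseteq>) rs cs"
  define W :: "complex mat" where "W = relation_matrix (\<lambda>T S. S \<subseteq> T) vs cs"
  have A': "A = relation_matrix (\<lambda>T T'. (T, T') \<in> parcs ?G) vs vs"
    by (simp add: A adjacency_matrix_def relation_matrix_def)
  have carr: "D \<in> carrier_mat (length rs) (length cs)" "W \<in> carrier_mat (length vs) (length cs)"
    "A \<in> carrier_mat (length vs) (length vs)"
    by (simp_all add: D_def W_def A')
  \<comment> \<open>For \<open>i = 0\<close> the list \<open>rs\<close> is empty and \<open>D\<close> has no rows, in accordance with the convention
    that the second binomial coefficient is \<open>0\<close>.\<close>
  have kernel_D: "\<exists>f. v = vec_of_fun cs f \<and> harmonic ?\<Omega> i f" if v: "v \<in> mat_kernel D" for v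
  proof -
    obtain f where f: "v = vec_of_fun cs f"
      using vec_of_fun_surj[OF cs(2) mat_kernelD(1)[OF carr(1) v]] .
    have "D *\<^sub>v v = 0\<^sub>v (length rs)" by (rule mat_kernelD(2)[OF carr(1) v])
    then have "\<forall>R\<in>set rs. (\<Sum>S\<in>{S \<in> set cs. R \<subseteq> S}. f S) = 0"
      unfolding D_def f relation_matrix_mult_vec_of_fun[OF cs(2)] vec_of_fun_0 vec_of_fun_eq_iff .
    then have "(\<Sum>x\<in>?\<Omega> - R. f (insert x R)) = 0" if "R \<subseteq> ?\<Omega>" "Suc (card R) = i" for R
      unfolding rs cs sum_supersets[OF fin that, symmetric] using that by blast
    then have "harmonic ?\<Omega> i f"
      unfolding harmonic_def by blast
    with f show ?thesis by blast
  qed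
  have W_mult: "W *\<^sub>v vec_of_fun cs f = vec_of_fun vs (subset_sum i f)" for f
  proof -
    have "{S \<in> k_subsets ?\<Omega> i. S \<subseteq> T} = k_subsets T i" if "T \<in> k_subsets ?\<Omega> m" for T
      using that by (auto simp: k_subsets_def)
    then show ?thesis
      unfolding W_def relation_matrix_mult_vec_of_fun[OF cs(2)] vec_of_fun_eq_iff
      by (simp add: cs vs' subset_sum_def)
  qed
  have "length cs - length rs \<le> kernel_dim D"
    by (rule kernel_dim_ge[OF carr(1)])
  also have "\<dots> \<le> kernel_dim (char_matrix A ?\<theta>)"
  proof (rule kernel_dim_mono_injective[OF carr(1,2)])
    show "char_matrix A ?\<theta> \<in> carrier_mat (length vs) (length vs)"
      using carr(3) by simp
  next
    fix v assume "v \<in> mat_kernel D"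
    then obtain f where f: "v = vec_of_fun cs f" and h: "harmonic ?\<Omega> i f"
      using kernel_D by blast
    have "A *\<^sub>v vec_of_fun vs (subset_sum i f) = ?\<theta> \<cdot>\<^sub>v vec_of_fun vs (subset_sum i f)"
    proof -
      have smult: "?\<theta> \<cdot>\<^sub>v vec_of_fun vs (subset_sum i f) = vec_of_fun vs (\<lambda>T. ?\<theta> * subset_sum i f T)"
        by (auto simp: vec_of_fun_def)
      show ?thesis
        unfolding A' relation_matrix_mult_vec_of_fun[OF vs(1)] smult vec_of_fun_eq_iff vs'
        using enhanced_johnson_neighbour_sum[OF h m] by blast
    qed
    then show "W *\<^sub>v v \<in> mat_kernel (char_matrix A ?\<theta>)"
      unfolding f W_mult using carr(3)
      by (intro mat_kernelI[of _ "length vs" "length vs"] char_matrix_mult_eq_0) auto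
  next
    fix v assume "v \<in> mat_kernel D" and 0: "W *\<^sub>v v = 0\<^sub>v (length vs)"
    then obtain f where f: "v = vec_of_fun cs f" and h: "harmonic ?\<Omega> i f"
      using kernel_D by blast
    have "\<forall>T\<in>k_subsets ?\<Omega> m. subset_sum i f T = 0"
      using 0 unfolding f W_mult vec_of_fun_0 vec_of_fun_eq_iff vs' .
    then have "f S = 0" if "S \<in> k_subsets ?\<Omega> i" for S
      using harmonic_eq_0_if_subset_sum_eq_0[OF fin h i _ _ that] i by simp
    then show "v = 0\<^sub>v (length cs)"
      by (simp add: f vec_of_fun_0 vec_of_fun_eq_iff cs)
  qed
  also have "\<dots> \<le> Polynomial.order ?\<theta> (char_poly A)"
    by (rule kernel_dim_char_matrix_le_order[OF carr(3)])
  finally have "length cs - length rs \<le> Polynomial.order ?\<theta> (char_poly A)" .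
  moreover have "length cs = (2 * m) choose i"
    using distinct_card[OF cs(2)] cs(1) card_k_subsets[OF fin, of i] by simp
  moreover have "length rs = (if i = 0 then 0 else (2 * m) choose (i - 1))"
  proof -
    have "?L = (if i = 0 then {} else k_subsets ?\<Omega> (i - 1))"
      by (auto simp: k_subsets_def)
    then show ?thesis
      using distinct_card[OF rs(2)] unfolding rs(1)
      by (cases "i = 0") (simp_all add: card_k_subsets)
  qed
  ultimately show ?thesis
    by (cases "i = 0") (simp_all add: enhanced_johnson_multiplicity_def nat_diff_distrib')
qed

section \<open>Distinctness of the eigenvalues and the sum of the multiplicities\<close>

lemma sum_enhanced_johnson_multiplicity:
  "(\<Sum>i\<le>k. enhanced_johnson_multiplicity m i) = int ((2 * m) choose k)"
  by (induction k) (simp_all add: enhanced_johnson_multiplicity_def)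

lemma enhanced_johnson_multiplicity_pos:
  assumes "i \<le> m"
  shows "enhanced_johnson_multiplicity m i > 0"
  using assms binomial_strict_mono[of "i - 1" i "2 * m"]
  by (cases "i = 0") (simp_all add: enhanced_johnson_multiplicity_def)

text \<open>
  Consecutive values differ by \<open>2 * (m - i) + 2 * (-1)^i\<close>, which is positive unless
  \<open>i = m - 1\<close> is odd; this is excluded for odd \<open>m\<close>. For positive even \<open>m\<close> the last two values coincide.
\<close>

lemma inj_on_enhanced_johnson_eigenvalue:
  assumes "odd m"
  shows "inj_on (enhanced_johnson_eigenvalue m) {..m}"
proof -
  have step: "enhanced_johnson_eigenvalue m (Suc i) < enhanced_johnson_eigenvalue m i" if "i < m" for i
  proof -
    have diff: "enhanced_johnson_eigenvalue m i - enhanced_johnson_eigenvalue m (Suc i)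
        = 2 * (int m - int i) + 2 * (-1) ^ i"
      by (simp add: enhanced_johnson_eigenvalue_def johnson_eigenvalue_def power2_eq_square algebra_simps)
    show ?thesis
    proof (cases "even i")
      case False
      \<comment> \<open>As \<open>m - 1\<close> is even, the odd number \<open>i < m\<close> is at most \<open>m - 2\<close>.\<close>
      then have "i + 2 \<le> m" using that assms by presburger
      then show ?thesis using diff False by simp
    qed (use diff that in simp)
  qed
  have less: "enhanced_johnson_eigenvalue m j < enhanced_johnson_eigenvalue m i"
    if "i < j" "j \<le> m" for i j
    using that
  proof (induction j rule: less_induct)
    case (less j)
    then obtain k where k: "j = Suc k" by (cases j) auto
    show ?case
    proof (cases "i = k")
      case False
      then have "enhanced_johnson_eigenvalue m k < enhanced_johnson_eigenvalue m i"
        using less k by simp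
      then show ?thesis using step[of k] less k by simp
    qed (use step[of k] less k in simp)
  qed
  show ?thesis
    using less by (intro linorder_inj_onI) (auto, metis order_less_irrefl)
qed

section \<open>The spectrum\<close>

theorem theorem3p11:
  fixes m :: nat and vs :: "nat set list" and A :: "complex mat"
  assumes "m \<ge> 3" and "odd m"
    and "distinct vs" and "set vs = pverts (enhanced_johnson_graph m)"
    and "A = adjacency_matrix (enhanced_johnson_graph m) vs"
  shows "spectrum A = {of_int (enhanced_johnson_eigenvalue m i) | i. i \<le> m} \<and>
    (\<forall>i\<le>m. int (Polynomial.order (of_int (enhanced_johnson_eigenvalue m i)) (char_poly A)) =
             enhanced_johnson_multiplicity m i)"
proof -
  let ?\<theta> = "\<lambda>i. of_int (enhanced_johnson_eigenvalue m i) :: complex"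
  let ?d = "\<lambda>i. nat (enhanced_johnson_multiplicity m i)"
  have A: "A \<in> carrier_mat (length vs) (length vs)"
    by (simp add: assms(5) adjacency_matrix_def)
  have "length vs = (2 * m) choose m"
    using distinct_card[OF assms(3)] assms(4) card_k_subsets[of "{1..2 * m}" m]
    by (simp add: pverts_enhanced_johnson_graph)
  then have degree: "degree (char_poly A) = (2 * m) choose m" and "char_poly A \<noteq> 0"
    using degree_monic_char_poly[OF A] by auto
  have "inj_on ?\<theta> {..m}"
    using inj_on_enhanced_johnson_eigenvalue[OF assms(2)] by (simp add: inj_on_def)
  moreover have "(\<Sum>i\<le>m. ?d i) = degree (char_poly A)"
  proof -
    have "int (\<Sum>i\<le>m. ?d i) = (\<Sum>i\<le>m. enhanced_johnson_multiplicity m i)"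
      unfolding of_nat_sum
      by (rule sum.cong) (simp_all add: enhanced_johnson_multiplicity_pos less_imp_le)
    then have "int (\<Sum>i\<le>m. ?d i) = int (degree (char_poly A))"
      by (simp only: sum_enhanced_johnson_multiplicity degree)
    then show ?thesis by (simp only: of_nat_eq_iff)
  qed
  moreover have "?d i \<le> Polynomial.order (?\<theta> i) (char_poly A)" if "i \<in> {..m}" for i
    using enhanced_johnson_order_ge[OF _ _ assms(3-5)] assms(1) that by simp
  moreover have "0 < ?d i" if "i \<in> {..m}" for i
    using enhanced_johnson_multiplicity_pos that by simp
  ultimately have roots: "{x. poly (char_poly A) x = 0} = ?\<theta> ` {..m}"
    and order: "\<And>i. i \<in> {..m} \<Longrightarrow> Polynomial.order (?\<theta> i) (char_poly A) = ?d i"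
    using order_eq_if_lower_bounds_exhaust_degree[OF \<open>char_poly A \<noteq> 0\<close>, of "{..m}" ?\<theta> ?d] by auto
  have "spectrum A = {?\<theta> i | i. i \<le> m}"
    unfolding spectrum_root_char_poly[OF A] roots by auto
  moreover have "int (Polynomial.order (?\<theta> i) (char_poly A)) = enhanced_johnson_multiplicity m i"
    if "i \<le> m" for i
    using order[of i] enhanced_johnson_multiplicity_pos[of i m] that by simp
  ultimately show ?thesis by blast
qed

end
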